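(* Let $\mathcal{X}\subset\mathbb{R}^n$, let $\psi(x,\xi)$ be real-valued and differentiable in $x$, and let $\tilde\phi$ be a smoothing function of $\phi:\mathbb{R}\to\mathbb{R}$. Suppose there are constants $G_1,G_2>0$ such that $$\mathbb{E}[\|\nabla_x\psi(x,\xi)\|^2]\le G_1^2\ \text{ for all }x\in\mathcal{X},\qquad \mathbb{E}[\tilde\phi'(\psi(x,\xi),\mu)^2]\le\left(\frac{G_2}{\mu}\right)^2\ \text{ for all }x\in\mathcal{X},\ \mu>0.$$ Assume additionally that $\psi(x,\xi^1)$ is sampled independently from $\nabla_x\psi(x,\xi^2)$, where $\xi^1,\xi^2$ are independent samples of $\xi$. Then, for all $x\in\mathcal{X}$ and $\mu>0$, $$\mathbb{E}\left[\|\tilde\phi'(\psi(x,\xi^1),\mu)\,\nabla_x\psi(x,\xi^2)\|^2\right]\le\left(\frac{G_1G_2}{\mu}\right)^2.$$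
   Context: The setting is the compositional objective $f(x)=\phi(\mathbb{E}[\psi(x,\xi)])$, with $\xi$ a random vector and $\phi:\mathbb{R}\to\mathbb{R}$ locally Lipschitz and possibly non-smooth. A smoothing function of $\phi$ is a function $\tilde\phi:\mathbb{R}\times[0,+\infty)\to\mathbb{R}$ such that $\tilde\phi(\cdot,\mu)$ is continuously differentiable for each $\mu>0$ and $\lim_{z\to t,\,\mu\downarrow0}\tilde\phi(z,\mu)=\phi(t)$ for all $t$. $\tilde\phi'(\cdot,\mu)$ denotes the derivative of $\tilde\phi(\cdot,\mu)$ with respect to its first argument. *)

theory Defs
  imports "HOL-Analysis.Analysis" "HOL-Probability.Probability"
begin

definition locally_lipschitz :: "(real \<Rightarrow> real) \<Rightarrow> bool"
  where "locally_lipschitz \<phi> \<longleftrightarrow> (\<forall>t. \<exists>r>0. \<exists>L. L-lipschitz_on (cball t r) \<phi>)"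

(* The second argument of a smoothing function ranges over [0, \<infinity>). It is typed as real here,
   and only values at \<mu> > 0 enter the definition. The joint limit z \<rightarrow> t, \<mu> \<down> 0 is the limit at
   (t, 0) along pairs with \<mu> > 0, where z = t is allowed. *)
definition smoothing_function :: "(real \<Rightarrow> real) \<Rightarrow> (real \<Rightarrow> real \<Rightarrow> real) \<Rightarrow> bool"
  where "smoothing_function \<phi> \<phi>s \<longleftrightarrow>
    (\<forall>\<mu>>0. (\<lambda>z. \<phi>s z \<mu>) C1_differentiable_on UNIV) \<and>
    (\<forall>t. ((\<lambda>(z, \<mu>). \<phi>s z \<mu>) \<longlongrightarrow> \<phi> t) (at (t, 0) within UNIV \<times> {0<..}))"

end

theory Submission
  imports Defs
begin

text \<open>The squared norm of a scalar multiple of a vector is the product of the squared scalar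
  and the squared norm of the vector. Here the scalar depends only on \<open>\<xi>1\<close> and the
  vector only on \<open>\<xi>2\<close>, so independence turns the expectation of the product into a
  product of expectations (\<open>indep_var_nn_integral_mult\<close>). Both samples have the law of
  \<open>\<xi>\<close>, so the two factors are the second moments bounded by hypothesis, and the
  bounds multiply. What needs care is measurability of the two factors as functions of the sample:
  \<open>C1_differentiable_on_continuous_deriv\<close> serves the scalar,
  \<open>borel_measurable_GDERIV\<close> the gradient. All expectations are integrals of nonnegative
  functions, so no integrability has to be checked.\<close>

text \<open>Each component of the gradient is a pointwise limit of measurable difference quotients.
  The quotients evaluate \<open>f\<close> at points near \<open>x\<close>, so measurability is asked
  at every \<open>y\<close>, whereas differentiability is asked at \<open>x\<close> alone.\<close>

lemma borel_measurable_GDERIV: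
  fixes f :: "'a::euclidean_space \<Rightarrow> 'b \<Rightarrow> real"
  assumes meas: "\<And>y. f y \<in> borel_measurable N"
    and deriv: "\<And>s. GDERIV (\<lambda>y. f y s) x :> g s"
  shows "g \<in> borel_measurable N"
proof -
  have "(\<lambda>s. g s \<bullet> b) \<in> borel_measurable N" for b
  proof (rule borel_measurable_LIMSEQ_real)
    show "(\<lambda>s. (f (x + inverse (real (Suc k)) *\<^sub>R b) s - f x s) / inverse (real (Suc k)))
        \<in> borel_measurable N" for k
      using meas by measurable
    show "(\<lambda>k. (f (x + inverse (real (Suc k)) *\<^sub>R b) s - f x s) / inverse (real (Suc k)))
        \<longlonglongrightarrow> g s \<bullet> b" for s
    proof -
      have line: "((\<lambda>t. x + t *\<^sub>R b) has_derivative (\<lambda>t. t *\<^sub>R b)) (at 0)"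
        by (auto intro!: derivative_eq_intros)
      \<comment> \<open>The base point is written as the value of the line at parameter 0, so that
        the chain rule applies directly.\<close>
      have f: "((\<lambda>y. f y s) has_derivative (\<lambda>h. h \<bullet> g s)) (at (x + 0 *\<^sub>R b))"
        using deriv[of s] by (simp add: gderiv_def)
      have "((\<lambda>t. f (x + t *\<^sub>R b) s) has_derivative (\<lambda>t. (t *\<^sub>R b) \<bullet> g s)) (at 0)"
        using has_derivative_compose[OF line f] by simp
      \<comment> \<open>The directional derivative is a limit over all real t; restricting it to t =
        1/(k+1) gives a countable limit, which preserves measurability.\<close>
      then have "((\<lambda>t. f (x + t *\<^sub>R b) s) has_field_derivative (g s \<bullet> b)) (at 0)"
        by (simp add: has_field_derivative_def inner_commute mult.commute[of _ "g s \<bullet> b"]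
            mult_commute_abs)
      then have "((\<lambda>t. (f (x + t *\<^sub>R b) s - f x s) / t) \<longlongrightarrow> g s \<bullet> b) (at 0)"
        by (simp add: DERIV_def)
      moreover have "filterlim (\<lambda>k. inverse (real (Suc k))) (at 0) sequentially"
        using LIMSEQ_inverse_real_of_nat by (simp add: filterlim_at)
      ultimately show ?thesis
        by (rule filterlim_compose)
    qed
  qed
  then show ?thesis
    by (simp add: borel_measurable_euclidean_space[where f=g])
qed

text \<open>Independence says that the joint law is the product of the marginal laws, and Tonelli's
  theorem then separates the variables. Leaving the result in terms of the marginal laws lets
  equality of distributions be substituted directly.\<close>

lemma (in prob_space) indep_var_nn_integral_mult:
  assumes ind: "indep_var S X T Y"
    and f: "f \<in> borel_measurable S" and g: "g \<in> borel_measurable T"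
  shows "(\<integral>\<^sup>+ \<omega>. f (X \<omega>) * g (Y \<omega>) \<partial>M)
    = (\<integral>\<^sup>+ s. f s \<partial>distr M S X) * (\<integral>\<^sup>+ t. g t \<partial>distr M T Y)"
proof -
  have X [measurable]: "random_variable S X" and Y [measurable]: "random_variable T Y"
    and eq: "distr M S X \<Otimes>\<^sub>M distr M T Y = distr M (S \<Otimes>\<^sub>M T) (\<lambda>\<omega>. (X \<omega>, Y \<omega>))"
    using ind by (auto simp: indep_var_distribution_eq)
  interpret Y: prob_space "distr M T Y"
    by (rule prob_space_distr) (rule Y)
  note f [measurable] g [measurable]
  have "(\<integral>\<^sup>+ \<omega>. f (X \<omega>) * g (Y \<omega>) \<partial>M)
      = (\<integral>\<^sup>+ p. f (fst p) * g (snd p) \<partial>distr M (S \<Otimes>\<^sub>M T) (\<lambda>\<omega>. (X \<omega>, Y \<omega>)))"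
    by (subst nn_integral_distr) auto
  also have "\<dots> = (\<integral>\<^sup>+ s. \<integral>\<^sup>+ t. f s * g t \<partial>distr M T Y \<partial>distr M S X)"
    unfolding eq[symmetric] by (subst Y.nn_integral_fst[symmetric]) auto
  also have "\<dots> = (\<integral>\<^sup>+ s. f s \<partial>distr M S X) * (\<integral>\<^sup>+ t. g t \<partial>distr M T Y)"
    by (simp add: nn_integral_cmult nn_integral_multc)
  finally show ?thesis .
qed

text \<open>The C1 property only supplies some continuous derivative \<open>D\<close>; uniqueness of
  derivatives identifies it with \<open>deriv f\<close>.\<close>

lemma C1_differentiable_on_continuous_deriv:
  fixes f :: "real \<Rightarrow> real"
  assumes "f C1_differentiable_on UNIV"
  shows "continuous_on UNIV (deriv f)"
proof -
  obtain D where D: "\<And>z. (f has_vector_derivative D z) (at z)" "continuous_on UNIV D"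
    using assms by (auto simp: C1_differentiable_on_def)
  have "deriv f = D"
    using D(1) by (auto intro!: DERIV_imp_deriv simp: has_real_derivative_iff_has_vector_derivative)
  with D(2) show ?thesis
    by simp
qed

theorem proposition4p1:
  fixes M :: "'w measure"
    and \<xi> \<xi>1 \<xi>2 :: "'w \<Rightarrow> real ^ 'm"
    and X :: "(real ^ 'n) set"
    and \<psi> :: "real ^ 'n \<Rightarrow> real ^ 'm \<Rightarrow> real"
    and grad_\<psi> :: "real ^ 'n \<Rightarrow> real ^ 'm \<Rightarrow> real ^ 'n"
    and \<phi> :: "real \<Rightarrow> real"
    and \<phi>s :: "real \<Rightarrow> real \<Rightarrow> real"
    and G1 G2 :: real
  assumes "prob_space M"
    and "\<xi> \<in> borel_measurable M"
    and "locally_lipschitz \<phi>"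
    and "smoothing_function \<phi> \<phi>s"
    and "\<And>x. \<psi> x \<in> borel_measurable borel"
    and "\<And>x s. x \<in> X \<Longrightarrow> GDERIV (\<lambda>y. \<psi> y s) x :> grad_\<psi> x s"
    and "G1 > 0" and "G2 > 0"
    and "\<And>x. x \<in> X \<Longrightarrow>
      (\<integral>\<^sup>+ \<omega>. ennreal ((norm (grad_\<psi> x (\<xi> \<omega>)))\<^sup>2) \<partial>M) \<le> ennreal (G1\<^sup>2)"
    and "\<And>x \<mu>. x \<in> X \<Longrightarrow> \<mu> > 0 \<Longrightarrow>
      (\<integral>\<^sup>+ \<omega>. ennreal ((deriv (\<lambda>z. \<phi>s z \<mu>) (\<psi> x (\<xi> \<omega>)))\<^sup>2) \<partial>M) \<le> ennreal ((G2 / \<mu>)\<^sup>2)"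
    and "\<xi>1 \<in> borel_measurable M" and "distr M borel \<xi>1 = distr M borel \<xi>"
    and "\<xi>2 \<in> borel_measurable M" and "distr M borel \<xi>2 = distr M borel \<xi>"
    and "prob_space.indep_var M borel \<xi>1 borel \<xi>2"
  shows "\<forall>x\<in>X. \<forall>\<mu>>0.
    (\<integral>\<^sup>+ \<omega>. ennreal ((norm (deriv (\<lambda>z. \<phi>s z \<mu>) (\<psi> x (\<xi>1 \<omega>)) *\<^sub>R grad_\<psi> x (\<xi>2 \<omega>)))\<^sup>2) \<partial>M)
      \<le> ennreal ((G1 * G2 / \<mu>)\<^sup>2)"
proof (intro ballI allI impI)
  fix x \<mu> assume x: "x \<in> X" and \<mu>: "(\<mu>::real) > 0"
  interpret prob_space M by fact
  note \<xi> = assms(2) and \<psi> [measurable] = assms(5)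
    and \<xi>1 = assms(11,12) and \<xi>2 = assms(13,14) and ind = assms(15)
  let ?d = "deriv (\<lambda>z. \<phi>s z \<mu>)"
  \<comment> \<open>\<open>f\<close> and \<open>g\<close> are functions of a single sample value, so
    each can be integrated against the common law of the samples.\<close>
  define f where "f s = ennreal ((?d (\<psi> x s))\<^sup>2)" for s
  define g where "g s = ennreal ((norm (grad_\<psi> x s))\<^sup>2)" for s
  have "continuous_on UNIV ?d"
    using assms(4) \<mu> by (intro C1_differentiable_on_continuous_deriv) (simp add: smoothing_function_def)
  then have [measurable]: "?d \<in> borel_measurable borel"
    by (rule borel_measurable_continuous_onI)
  have [measurable]: "grad_\<psi> x \<in> borel_measurable borel"
    by (rule borel_measurable_GDERIV[where f=\<psi>, OF assms(5) assms(6)[OF x]])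
  have f [measurable]: "f \<in> borel_measurable borel" and g [measurable]: "g \<in> borel_measurable borel"
    unfolding f_def g_def by measurable
  have "(\<integral>\<^sup>+ \<omega>. ennreal ((norm (?d (\<psi> x (\<xi>1 \<omega>)) *\<^sub>R grad_\<psi> x (\<xi>2 \<omega>)))\<^sup>2) \<partial>M)
      = (\<integral>\<^sup>+ \<omega>. f (\<xi>1 \<omega>) * g (\<xi>2 \<omega>) \<partial>M)"
    by (simp add: f_def g_def power_mult_distrib ennreal_mult)
  \<comment> \<open>Independence splits the integral, and both marginal laws are replaced by that of
    \<open>\<xi>\<close>, the variable for which the moment bounds are given.\<close>
  also have "\<dots> = (\<integral>\<^sup>+ s. f s \<partial>distr M borel \<xi>) * (\<integral>\<^sup>+ s. g s \<partial>distr M borel \<xi>)"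
    using indep_var_nn_integral_mult[OF ind f g] \<xi>1(2) \<xi>2(2) by simp
  also have "\<dots> = (\<integral>\<^sup>+ \<omega>. f (\<xi> \<omega>) \<partial>M) * (\<integral>\<^sup>+ \<omega>. g (\<xi> \<omega>) \<partial>M)"
    using \<xi> by (simp add: nn_integral_distr)
  also have "\<dots> \<le> ennreal ((G2 / \<mu>)\<^sup>2) * ennreal (G1\<^sup>2)"
    unfolding f_def g_def by (intro mult_mono assms(9)[OF x] assms(10)[OF x \<mu>]) auto
  also have "\<dots> = ennreal ((G1 * G2 / \<mu>)\<^sup>2)"
    by (simp add: ennreal_mult[symmetric] power_mult_distrib power_divide mult.commute)
  finally show "(\<integral>\<^sup>+ \<omega>. ennreal ((norm (?d (\<psi> x (\<xi>1 \<omega>)) *\<^sub>R grad_\<psi> x (\<xi>2 \<omega>)))\<^sup>2) \<partial>M)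
      \<le> ennreal ((G1 * G2 / \<mu>)\<^sup>2)" .
qed

end
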